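(* Let $m$ be a positive integer. If there exists a symmetric 2-$(4m - 1, 2m - 1, m - 1)$ design, then there exists a resolvable $((4m - 1) \times 4m,\ 8m - 2)$-unordered triple array.
   Context: A 2-$(v,k,\lambda)$ design is a collection of $k$-subsets (blocks) of a $v$-set such that each pair of distinct points lies in exactly $\lambda$ blocks; it is symmetric if it has exactly $v$ blocks. An $(r \times c, v)$-unordered triple array on a set $V$ of $v$ symbols is a collection of $c$-subsets $R_1, \dots, R_r \subseteq V$ (row-sets) and $r$-subsets $C_1, \dots, C_c \subseteq V$ (column-sets) such that, for some integers $e, \lambda_{rc}, \lambda_{rr}, \lambda_{cc}$, each symbol lies in exactly $e$ row-sets and exactly $e$ column-sets, $|R_i \cap C_j| = \lambda_{rc}$ for all $i,j$, $|R_i \cap R_s| = \lambda_{rr}$ for all $i \neq s$, and $|C_j \cap C_t| = \lambda_{cc}$ for all $j \neq t$. Necessarily $e = rc/v$. Such an unordered triple array is called resolvable if $\lambda_{rrc} := \frac{e(e-1)}{r-1}$ and $k := \frac{c}{e}$ are integers and the symbol set can be partitioned into $r$ groups of size $k$ such that every column-set contains exactly one symbol from each group, and all symbols of a group lie in exactly the same row-sets. *)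

theory Defs
  imports Main "HOL-Library.Multiset" "HOL-Library.Disjoint_Sets"
begin

(* Blocks form a multiset: a collection of blocks may contain repetitions. *)
definition two_design ::
  "nat \<Rightarrow> nat \<Rightarrow> nat \<Rightarrow> 'a set \<Rightarrow> 'a set multiset \<Rightarrow> bool" where
  "two_design v k l X \<B> \<longleftrightarrow>
     finite X \<and> card X = v \<and>
     (\<forall>B\<in>#\<B>. B \<subseteq> X \<and> card B = k) \<and>
     (\<forall>x\<in>X. \<forall>y\<in>X. x \<noteq> y \<longrightarrow> size {#B \<in># \<B>. x \<in> B \<and> y \<in> B#} = l)"

definition symmetric_two_design ::
  "nat \<Rightarrow> nat \<Rightarrow> nat \<Rightarrow> 'a set \<Rightarrow> 'a set multiset \<Rightarrow> bool" where
  "symmetric_two_design v k l X \<B> \<longleftrightarrow> two_design v k l X \<B> \<and> size \<B> = v"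

(* Only the values R 1, ..., R r and C 1, ..., C c are relevant. *)
definition uta_with_parameters ::
  "nat \<Rightarrow> nat \<Rightarrow> nat \<Rightarrow> 'a set \<Rightarrow> (nat \<Rightarrow> 'a set) \<Rightarrow> (nat \<Rightarrow> 'a set) \<Rightarrow>
   nat \<Rightarrow> nat \<Rightarrow> nat \<Rightarrow> nat \<Rightarrow> bool" where
  "uta_with_parameters r c v V R C e lrc lrr lcc \<longleftrightarrow>
     finite V \<and> card V = v \<and>
     (\<forall>i\<in>{1..r}. R i \<subseteq> V \<and> card (R i) = c) \<and>
     (\<forall>j\<in>{1..c}. C j \<subseteq> V \<and> card (C j) = r) \<and>
     (\<forall>x\<in>V. card {i\<in>{1..r}. x \<in> R i} = e \<and> card {j\<in>{1..c}. x \<in> C j} = e) \<and>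
     (\<forall>i\<in>{1..r}. \<forall>j\<in>{1..c}. card (R i \<inter> C j) = lrc) \<and>
     (\<forall>i\<in>{1..r}. \<forall>s\<in>{1..r}. i \<noteq> s \<longrightarrow> card (R i \<inter> R s) = lrr) \<and>
     (\<forall>j\<in>{1..c}. \<forall>t\<in>{1..c}. j \<noteq> t \<longrightarrow> card (C j \<inter> C t) = lcc)"

definition unordered_triple_array ::
  "nat \<Rightarrow> nat \<Rightarrow> nat \<Rightarrow> 'a set \<Rightarrow> (nat \<Rightarrow> 'a set) \<Rightarrow> (nat \<Rightarrow> 'a set) \<Rightarrow> bool" where
  "unordered_triple_array r c v V R C \<longleftrightarrow>
     (\<exists>e lrc lrr lcc. uta_with_parameters r c v V R C e lrc lrr lcc)"

(* The two divisibility conditions say that e(e-1)/(r-1) and c/e are integers;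
   the first is stated over int to avoid truncated subtraction. *)
definition resolvable_unordered_triple_array ::
  "nat \<Rightarrow> nat \<Rightarrow> nat \<Rightarrow> 'a set \<Rightarrow> (nat \<Rightarrow> 'a set) \<Rightarrow> (nat \<Rightarrow> 'a set) \<Rightarrow> bool" where
  "resolvable_unordered_triple_array r c v V R C \<longleftrightarrow>
     (\<exists>e lrc lrr lcc. uta_with_parameters r c v V R C e lrc lrr lcc \<and>
        (int r - 1) dvd int e * (int e - 1) \<and>
        e > 0 \<and> e dvd c \<and>
        (\<exists>\<G>. partition_on V \<G> \<and> card \<G> = r \<and>
           (\<forall>G\<in>\<G>. card G = c div e) \<and>
           (\<forall>j\<in>{1..c}. \<forall>G\<in>\<G>. card (C j \<inter> G) = 1) \<and>
           (\<forall>G\<in>\<G>. \<forall>x\<in>G. \<forall>y\<in>G. \<forall>i\<in>{1..r}. x \<in> R i \<longleftrightarrow> y \<in> R i)))"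

lemma resolvable_imp_unordered_triple_array:
  "resolvable_unordered_triple_array r c v V R C \<Longrightarrow> unordered_triple_array r c v V R C"
  unfolding resolvable_unordered_triple_array_def unordered_triple_array_def
  by (elim exE conjE) (intro exI)

end

theory Submission
  imports Defs
begin

text \<open>
  If \<open>B\<^sub>1, \<dots>, B\<^sub>4\<^sub>m\<^sub>-\<^sub>1\<close> are the blocks of the design on the point set \<open>X\<close>, the symbols are
  \<open>X \<times> {0, 1}\<close>, the groups are the pairs \<open>{x} \<times> {0, 1}\<close>, the row-sets are
  \<open>(X - B\<^sub>i) \<times> {0, 1}\<close>, and the column-sets are the graphs of the indicator functions of
  \<open>B\<^sub>1, \<dots>, B\<^sub>4\<^sub>m\<^sub>-\<^sub>1\<close> and \<open>X\<close>, that is, the rows of a normalised Hadamard matrix of order \<open>4m\<close>.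
  The intersection sizes come from the fact that two blocks of a symmetric design meet in
  \<open>\<lambda>\<close> points, which follows from a vanishing variance.
  For \<open>m = 1\<close> the hypothesis allows the three singleton blocks to coincide, so in that case
  the design with three distinct singletons is used instead.
\<close>

section \<open>Symmetric designs: replication number and block intersections\<close>

context
  fixes I :: "'i set" and X :: "'a set" and B :: "'i \<Rightarrow> 'a set" and v k l :: nat
  assumes finI: "finite I" and cardI: "card I = v"
    and finX: "finite X" and cardX: "card X = v"
    and block_subset: "\<And>i. i \<in> I \<Longrightarrow> B i \<subseteq> X"
    and block_card: "\<And>i. i \<in> I \<Longrightarrow> card (B i) = k"
    and pair_count:
      "\<And>x y. x \<in> X \<Longrightarrow> y \<in> X \<Longrightarrow> x \<noteq> y \<Longrightarrow> card {i\<in>I. x \<in> B i \<and> y \<in> B i} = l"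
    and k2: "k \<ge> 2"
begin

text \<open>Double count of the pairs formed by a block through \<open>x\<close> and a second point
  of that block.\<close>

lemma replication_times:
  assumes x: "x \<in> X"
  shows "card {i\<in>I. x \<in> B i} * (k - 1) = (v - 1) * l"
proof -
  let ?J = "{i\<in>I. x \<in> B i}"
  have "(\<Sum>i\<in>?J. card {y\<in>X - {x}. y \<in> B i}) = (\<Sum>y\<in>X - {x}. l)"
  proof (rule sum_multicount_gen)
    show "\<forall>y\<in>X - {x}. card {i\<in>?J. y \<in> B i} = l"
    proof
      fix y assume "y \<in> X - {x}"
      then show "card {i\<in>?J. y \<in> B i} = l"
        using pair_count[of x y] x by (auto simp: conj_assoc)
    qed
  qed (use finI finX in auto)
  moreover have "card {y\<in>X - {x}. y \<in> B i} = k - 1" if "i \<in> ?J" for i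
  proof -
    have "{y\<in>X - {x}. y \<in> B i} = B i - {x}"
      using block_subset[of i] that by auto
    then show ?thesis
      using block_card[of i] that by (simp add: card_Diff_singleton)
  qed
  ultimately show ?thesis
    using x finX cardX by (simp add: card_Diff_singleton)
qed

text \<open>Counting incidences, the replication numbers sum to \<open>v * k\<close>. After
  multiplication by \<open>k - 1\<close>, \<open>replication_times\<close> makes each summand
  \<open>(v - 1) * l\<close>, and \<open>v\<close> cancels. Symmetry enters here: \<open>I\<close>
  and \<open>X\<close> have the same size. The point \<open>x\<close> guarantees that
  \<open>v\<close> is positive.\<close>

lemma symmetric_design_parameters:
  assumes "x \<in> X"
  shows "(v - 1) * l = k * (k - 1)"
proof -
  have "(\<Sum>x\<in>X. card {i\<in>I. x \<in> B i}) = (\<Sum>i\<in>I. k)"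
  proof (rule sum_multicount_gen)
    show "\<forall>i\<in>I. card {x\<in>X. x \<in> B i} = k"
    proof
      fix i assume i: "i \<in> I"
      then have "{x\<in>X. x \<in> B i} = B i" using block_subset by auto
      then show "card {x\<in>X. x \<in> B i} = k" using block_card i by simp
    qed
  qed (use finI finX in auto)
  then have "v * k * (k - 1) = (\<Sum>x\<in>X. card {i\<in>I. x \<in> B i} * (k - 1))"
    by (simp add: cardI flip: sum_distrib_right)
  also have "\<dots> = (\<Sum>x\<in>X. (v - 1) * l)"
    by (rule sum.cong[OF refl replication_times])
  also have "\<dots> = v * ((v - 1) * l)" by (simp add: cardX)
  finally have "v * (k * (k - 1)) = v * ((v - 1) * l)" by (simp add: mult.assoc)
  moreover have "v > 0" using assms finX cardX card_gt_0_iff by blast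
  ultimately show ?thesis by (metis mult_cancel1 not_less0)
qed

text \<open>The factor \<open>k - 1\<close> is cancelled, which is where \<open>k2\<close> enters:
  for \<open>k = 1\<close>, \<open>replication_times\<close> puts no constraint on the replication
  number.\<close>

lemma symmetric_design_replication:
  assumes "x \<in> X"
  shows "card {i\<in>I. x \<in> B i} = k"
  using replication_times[OF assms] symmetric_design_parameters[OF assms] k2 by simp

text \<open>Over the \<open>v - 1\<close> blocks other than \<open>B i\<close>, the intersection
  sizes with \<open>B i\<close> sum to \<open>(v - 1) * l\<close> and their squares to
  \<open>(v - 1) * l\<^sup>2\<close>. Hence their squared deviations from \<open>l\<close> sum to 0,
  and each deviation is 0.\<close>

lemma symmetric_design_block_intersection:
  assumes i: "i \<in> I" and j: "j \<in> I" and ij: "i \<noteq> j"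
  shows "card (B i \<inter> B j) = l"
proof -
  define n where "n s = card {x\<in>B i. x \<in> B s}" for s
  let ?J = "I - {i}"
  have finB: "finite (B i)" using block_subset[OF i] finX finite_subset by blast
  have cardB: "card (B i) = k" using block_card[OF i] .
  obtain x0 where x0: "x0 \<in> B i" using cardB k2 by fastforce
  then have param: "(v - 1) * l = k * (k - 1)"
    using block_subset[OF i] symmetric_design_parameters by blast
  \<comment> \<open>All points counted below lie in \<open>B i\<close>, so the index
    \<open>i\<close> always satisfies \<open>P\<close> and dropping it lowers the count by exactly
    one.\<close>
  have without_i: "card {s\<in>?J. P s} = card {s\<in>I. P s} - 1" if "P i" for P
  proof -
    have "{s\<in>?J. P s} = {s\<in>I. P s} - {i}" by auto
    then show ?thesis using that i by (simp add: card_Diff_singleton)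
  qed
  have "(\<Sum>s\<in>?J. n s) = (\<Sum>x\<in>B i. k - 1)"
    unfolding n_def
  proof (rule sum_multicount_gen)
    show "\<forall>x\<in>B i. card {s\<in>?J. x \<in> B s} = k - 1"
      using symmetric_design_replication block_subset[OF i] without_i by (auto simp: subset_iff)
  qed (use finI finB in auto)
  then have sum1: "(\<Sum>s\<in>?J. n s) = (v - 1) * l" using param by (simp add: cardB)
  \<comment> \<open>The square of \<open>n s\<close> counts ordered pairs of points of
    \<open>B i\<close> that both lie in \<open>B s\<close>. Equal pairs are governed by the
    replication number \<open>k\<close>, distinct ones by \<open>l\<close>.\<close>
  have "(\<Sum>s\<in>?J. card {p\<in>B i \<times> B i. fst p \<in> B s \<and> snd p \<in> B s})
      = (\<Sum>p\<in>B i \<times> B i. if fst p = snd p then k - 1 else l - 1)"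
  proof (rule sum_multicount_gen)
    show "\<forall>p\<in>B i \<times> B i. card {s\<in>?J. fst p \<in> B s \<and> snd p \<in> B s}
        = (if fst p = snd p then k - 1 else l - 1)"
    proof
      fix p assume p: "p \<in> B i \<times> B i"
      then have "fst p \<in> X" "snd p \<in> X" "fst p \<in> B i" "snd p \<in> B i"
        using block_subset[OF i] by auto
      then show "card {s\<in>?J. fst p \<in> B s \<and> snd p \<in> B s}
          = (if fst p = snd p then k - 1 else l - 1)"
        using symmetric_design_replication[of "fst p"] pair_count[of "fst p" "snd p"]
        by (subst without_i) auto
    qed
  qed (use finI finB in auto)
  also have "\<dots> = (\<Sum>x\<in>B i. \<Sum>y\<in>B i. if x = y then k - 1 else l - 1)"
    by (simp add: sum.cartesian_product case_prod_beta)
  also have "\<dots> = (\<Sum>x\<in>B i. (k - 1) + (k - 1) * (l - 1))"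
  proof (rule sum.cong)
    fix x assume x: "x \<in> B i"
    have "(\<Sum>y\<in>B i - {x}. if x = y then k - 1 else l - 1) = (\<Sum>y\<in>B i - {x}. l - 1)"
      by (rule sum.cong) auto
    then show "(\<Sum>y\<in>B i. if x = y then k - 1 else l - 1) = (k - 1) + (k - 1) * (l - 1)"
      using x finB cardB by (simp add: sum.remove card_Diff_singleton)
  qed simp
  also have "\<dots> = k * (k - 1) * l"
  proof -
    \<comment> \<open>Positivity of \<open>l\<close> matters because \<open>l - 1\<close> is
      truncated: for \<open>l = 0\<close> the sum would be \<open>k * (k - 1)\<close>.\<close>
    have "l > 0" using param k2 by (cases l) auto
    then show ?thesis by (cases l) (auto simp: cardB algebra_simps)
  qed
  also have "\<dots> = (v - 1) * l\<^sup>2" using param by (simp add: power2_eq_square)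
  finally have sum2: "(\<Sum>s\<in>?J. (n s)\<^sup>2) = (v - 1) * l\<^sup>2"
  proof -
    have "card {p\<in>B i \<times> B i. fst p \<in> B s \<and> snd p \<in> B s} = (n s)\<^sup>2" for s
    proof -
      have "{p\<in>B i \<times> B i. fst p \<in> B s \<and> snd p \<in> B s}
          = {x\<in>B i. x \<in> B s} \<times> {x\<in>B i. x \<in> B s}" by auto
      then show ?thesis by (simp add: n_def card_cartesian_product power2_eq_square)
    qed
    moreover assume "(\<Sum>s\<in>?J. card {p\<in>B i \<times> B i. fst p \<in> B s \<and> snd p \<in> B s}) = (v - 1) * l\<^sup>2"
    ultimately show ?thesis by simp
  qed
  have cardJ: "card ?J = v - 1" using i finI cardI by (simp add: card_Diff_singleton)
  \<comment> \<open>The deviations may be negative, so the variance is computed over the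
    integers.\<close>
  have "(\<Sum>s\<in>?J. (int (n s) - int l)\<^sup>2)
      = (\<Sum>s\<in>?J. int ((n s)\<^sup>2)) - 2 * int l * (\<Sum>s\<in>?J. int (n s)) + (\<Sum>s\<in>?J. (int l)\<^sup>2)"
    by (simp add: power2_diff sum.distrib sum_subtractf sum_distrib_left algebra_simps)
  also have "\<dots> = int ((v - 1) * l\<^sup>2) - 2 * int l * int ((v - 1) * l) + int (v - 1) * (int l)\<^sup>2"
    by (simp only: sum1 sum2 cardJ sum_constant flip: of_nat_sum)
  also have "\<dots> = 0" by (simp add: power2_eq_square)
  finally have "(int (n j) - int l)\<^sup>2 = 0"
    using finI j ij by (subst (asm) sum_nonneg_eq_0_iff) auto
  then have "n j = l" by simp
  moreover have "{x\<in>B i. x \<in> B j} = B i \<inter> B j" by auto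
  ultimately show ?thesis by (simp add: n_def)
qed

end

section \<open>Counting symbols and building the array\<close>

lemma card_both_symbols:
  fixes S :: "nat set"
  assumes "S \<subseteq> {..<v}"
  shows "card {y\<in>{..<2 * v}. y div 2 \<in> S} = 2 * card S"
proof -
  have fin: "finite S" using assms finite_subset by blast
  have "{y\<in>{..<2 * v}. y div 2 \<in> S} = (\<lambda>p. 2 * p) ` S \<union> (\<lambda>p. 2 * p + 1) ` S"
  proof (intro equalityI subsetI)
    fix y assume "y \<in> {y\<in>{..<2 * v}. y div 2 \<in> S}"
    moreover have "y = 2 * (y div 2) \<or> y = 2 * (y div 2) + 1" by presburger
    ultimately show "y \<in> (\<lambda>p. 2 * p) ` S \<union> (\<lambda>p. 2 * p + 1) ` S" by blast
  qed (use assms in auto)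
  moreover have "(\<lambda>p. 2 * p) ` S \<inter> (\<lambda>p. 2 * p + 1) ` S = {}"
    by (auto; presburger)
  moreover have "card ((\<lambda>p. 2 * p) ` S) = card S" "card ((\<lambda>p. 2 * p + 1) ` S) = card S"
    by (auto intro!: card_image inj_onI)
  ultimately show ?thesis by (simp add: card_Un_disjoint fin)
qed

text \<open>A column takes one of the two symbols of each point, the odd one exactly when
  \<open>P\<close> holds. This gives the size of every intersection in which a column takes part,
  with \<open>S\<close> the set of points that contribute.\<close>

lemma card_chosen_symbols:
  fixes S :: "nat set"
  assumes "S \<subseteq> {..<v}"
  shows "card {y\<in>{..<2 * v}. y div 2 \<in> S \<and> (P (y div 2) \<longleftrightarrow> odd y)} = card S"
proof -
  let ?f = "\<lambda>p. 2 * p + of_bool (P p) :: nat"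
  have "{y\<in>{..<2 * v}. y div 2 \<in> S \<and> (P (y div 2) \<longleftrightarrow> odd y)} = ?f ` S"
  proof (intro equalityI subsetI)
    fix y assume y: "y \<in> {y\<in>{..<2 * v}. y div 2 \<in> S \<and> (P (y div 2) \<longleftrightarrow> odd y)}"
    then have "y = ?f (y div 2)" by auto
    with y show "y \<in> ?f ` S" by blast
  qed (use assms in auto)
  moreover have "inj_on ?f S"
  proof (rule inj_onI)
    fix p q assume "?f p = ?f q"
    then have "?f p div 2 = ?f q div 2" by simp
    then show "p = q" by simp
  qed
  ultimately show ?thesis by (simp add: card_image)
qed

text \<open>The pair \<open>(p, b) \<in> X \<times> {0, 1}\<close> is encoded as the symbol \<open>2p + b\<close>.\<close>

lemma resolvable_array_of_dual_design:
  fixes m :: nat and B :: "nat \<Rightarrow> nat set"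
  defines "v \<equiv> 4 * m - 1"
  assumes m: "m > 0"
    and block_subset: "\<And>i. i \<in> {1..v} \<Longrightarrow> B i \<subseteq> {..<v}"
    and block_card: "\<And>i. i \<in> {1..v} \<Longrightarrow> card (B i) = 2 * m - 1"
    and replication: "\<And>p. p < v \<Longrightarrow> card {i\<in>{1..v}. p \<in> B i} = 2 * m - 1"
    and intersection:
      "\<And>i j. i \<in> {1..v} \<Longrightarrow> j \<in> {1..v} \<Longrightarrow> i \<noteq> j \<Longrightarrow> card (B i \<inter> B j) = m - 1"
  shows "\<exists>(V :: nat set) R C. resolvable_unordered_triple_array v (4 * m) (8 * m - 2) V R C"
proof -
  define X where "X = {..<v}"
  define V where "V = {..<2 * v}"
  \<comment> \<open>\<open>D j\<close> is the set of points whose odd symbol belongs to column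
    \<open>j\<close>; the extra column \<open>4 * m\<close> consists of all odd symbols.\<close>
  define D where "D j = (if j = 4 * m then X else B j)" for j
  define R where "R i = {y\<in>V. y div 2 \<in> X - B i}" for i
  define C where "C j = {y\<in>V. y div 2 \<in> D j \<longleftrightarrow> odd y}" for j
  define \<G> where "\<G> = (\<lambda>p::nat. {2 * p, 2 * p + 1}) ` X"
  have finX: "finite X" and cardX: "card X = v" by (auto simp: X_def)
  have v: "v + 1 = 4 * m" using m by (simp add: v_def)
  have cols: "{1..4 * m} = insert (4 * m) {1..v}" using v by auto
  have last: "4 * m \<notin> {1..v}" using v by auto
  have D_block: "D j = B j" if "j \<in> {1..v}" for j using that v by (auto simp: D_def)
  have D_last: "D (4 * m) = X" by (simp add: D_def)
  have inX: "y div 2 \<in> X" if "y \<in> V" for y using that by (auto simp: V_def X_def)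
  have both: "card {y\<in>V. y div 2 \<in> S} = 2 * card S" if "S \<subseteq> X" for S
    using card_both_symbols[of S v] that by (simp add: V_def X_def)
  have chosen: "card {y\<in>V. y div 2 \<in> S \<and> (y div 2 \<in> T \<longleftrightarrow> odd y)} = card S" if "S \<subseteq> X" for S T
    using card_chosen_symbols[of S v "\<lambda>p. p \<in> T"] that by (simp add: V_def X_def)
  have BX: "B i \<subseteq> X" "finite (B i)" if "i \<in> {1..v}" for i
    using block_subset[OF that] finX finite_subset by (auto simp: X_def)
  have card_compl: "card (X - B i) = 2 * m" if "i \<in> {1..v}" for i
    using BX[OF that] block_card[OF that] m by (simp add: card_Diff_subset cardX v_def)
  \<comment> \<open>By inclusion-exclusion the union has 2(2m - 1) - (m - 1) = 3m - 1 of the 4m - 1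
    points.\<close>
  have outside: "card (X - (B i \<union> B j)) = m" if "i \<in> {1..v}" "j \<in> {1..v}" "i \<noteq> j" for i j
  proof -
    have "card (B i \<union> B j) + card (B i \<inter> B j) = card (B i) + card (B j)"
      using card_Un_Int[of "B i" "B j"] BX that by simp
    then have "card (B i \<union> B j) = 3 * m - 1"
      using intersection[OF that] block_card that m by simp
    then show ?thesis using BX that by (simp add: card_Diff_subset cardX v_def)
  qed
  have replication_compl: "card {i\<in>{1..v}. p \<notin> B i} = 2 * m" if "p \<in> X" for p
  proof -
    have "{i\<in>{1..v}. p \<notin> B i} = {1..v} - {i\<in>{1..v}. p \<in> B i}" by auto
    also have "card \<dots> = v - card {i\<in>{1..v}. p \<in> B i}"
      by (subst card_Diff_subset) auto
    finally have "card {i\<in>{1..v}. p \<notin> B i} = v - card {i\<in>{1..v}. p \<in> B i}" .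
    then show ?thesis using replication that m by (simp add: X_def v_def)
  qed

  have "uta_with_parameters v (4 * m) (8 * m - 2) V R C (2 * m) (2 * m) (2 * m) (2 * m - 1)"
    unfolding uta_with_parameters_def
  proof (intro conjI ballI impI)
    show "finite V" "card V = 8 * m - 2" by (auto simp: V_def v_def)
  next
    fix i assume i: "i \<in> {1..v}"
    show "R i \<subseteq> V" by (auto simp: R_def)
    show "card (R i) = 4 * m" using both[of "X - B i"] card_compl[OF i] by (simp add: R_def)
  next
    fix j
    show "C j \<subseteq> V" by (auto simp: C_def)
    have "C j = {y\<in>V. y div 2 \<in> X \<and> (y div 2 \<in> D j \<longleftrightarrow> odd y)}"
      using inX by (auto simp: C_def)
    then show "card (C j) = v" using chosen[of X "D j"] cardX by simp
  next
    fix y assume y: "y \<in> V"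
    have "{i\<in>{1..v}. y \<in> R i} = {i\<in>{1..v}. y div 2 \<notin> B i}"
      using y inX by (auto simp: R_def)
    then show "card {i\<in>{1..v}. y \<in> R i} = 2 * m"
      using replication_compl[OF inX[OF y]] by simp
    show "card {j\<in>{1..4 * m}. y \<in> C j} = 2 * m"
    \<comment> \<open>An odd symbol lies in the extra column and in those of the 2m - 1 blocks
      through its point; an even symbol lies in the columns of the 2m blocks that miss its
      point.\<close>
    proof (cases "odd y")
      case True
      then have "{j\<in>{1..4 * m}. y \<in> C j} = insert (4 * m) {j\<in>{1..v}. y div 2 \<in> B j}"
        using y inX[OF y] D_block D_last unfolding cols by (auto simp: C_def)
      then show ?thesis
        using replication inX[OF y] last m by (simp add: X_def)
    next
      case False
      then have "{j\<in>{1..4 * m}. y \<in> C j} = {j\<in>{1..v}. y div 2 \<notin> B j}"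
        using y inX[OF y] D_block D_last unfolding cols by (auto simp: C_def)
      then show ?thesis using replication_compl[OF inX[OF y]] by simp
    qed
  next
    fix i j assume i: "i \<in> {1..v}"
    have "R i \<inter> C j = {y\<in>V. y div 2 \<in> X - B i \<and> (y div 2 \<in> D j \<longleftrightarrow> odd y)}"
      by (auto simp: R_def C_def)
    then show "card (R i \<inter> C j) = 2 * m"
      using chosen[of "X - B i" "D j"] card_compl[OF i] by simp
  next
    fix i s assume i_s: "i \<in> {1..v}" "s \<in> {1..v}" "i \<noteq> s"
    have "R i \<inter> R s = {y\<in>V. y div 2 \<in> X - (B i \<union> B s)}"
      by (auto simp: R_def)
    then show "card (R i \<inter> R s) = 2 * m"
      using both[of "X - (B i \<union> B s)"] outside[OF i_s] by simp
  next
    fix j t assume jt: "j \<in> {1..4 * m}" "t \<in> {1..4 * m}" "j \<noteq> t"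
    \<comment> \<open>Two columns share one symbol for each point at which their indicator functions
      agree, and none elsewhere.\<close>
    let ?A = "{p\<in>X. p \<in> D j \<longleftrightarrow> p \<in> D t}"
    have "C j \<inter> C t = {y\<in>V. y div 2 \<in> ?A \<and> (y div 2 \<in> D j \<longleftrightarrow> odd y)}"
      using inX by (auto simp: C_def)
    then have "card (C j \<inter> C t) = card ?A"
      using chosen[of ?A "D j"] by simp
    also have "\<dots> = 2 * m - 1"
    proof -
      \<comment> \<open>Two blocks agree on their m - 1 common points and the m points outside both.
        A block and \<open>X\<close> agree on the block itself, which has 2m - 1 points.\<close>
      consider "j \<in> {1..v}" "t \<in> {1..v}" | "j = 4 * m" "t \<in> {1..v}" | "t = 4 * m" "j \<in> {1..v}"
        using jt unfolding cols by blast
      then show ?thesis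
      proof cases
        case 1
        have "?A = (B j \<inter> B t) \<union> (X - (B j \<union> B t))"
          using BX 1 by (auto simp: D_block)
        also have "card \<dots> = card (B j \<inter> B t) + card (X - (B j \<union> B t))"
          by (rule card_Un_disjoint) (use BX 1 finX in auto)
        finally show ?thesis
          using intersection outside 1 jt m by simp
      next
        case 2
        then have "?A = B t" using BX by (auto simp: D_block D_last)
        then show ?thesis using block_card 2 by simp
      next
        case 3
        then have "?A = B j" using BX by (auto simp: D_block D_last)
        then show ?thesis using block_card 3 by simp
      qed
    qed
    finally show "card (C j \<inter> C t) = 2 * m - 1" .
  qed
  \<comment> \<open>Here r - 1 = 2(2m - 1) and e = 2m, so the quotient e(e - 1)/(r - 1) is
    \<open>m\<close>.\<close>
  moreover have "(int v - 1) dvd int (2 * m) * (int (2 * m) - 1)"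
  proof -
    have "int v - 1 = 2 * (2 * int m - 1)" using arg_cong[OF v, of int] by simp
    then have "int (2 * m) * (int (2 * m) - 1) = (int v - 1) * int m" by simp
    then show ?thesis by (rule dvdI)
  qed
  moreover have "partition_on V \<G>"
  proof (rule partition_onI)
    show "\<Union>\<G> = V"
    proof (intro equalityI subsetI)
      fix y assume "y \<in> V"
      then have "y div 2 \<in> X" by (rule inX)
      moreover have "y \<in> {2 * (y div 2), 2 * (y div 2) + 1}" by (simp; presburger)
      ultimately show "y \<in> \<Union>\<G>" unfolding \<G>_def by blast
    qed (auto simp: \<G>_def V_def X_def)
    show "disjnt G H" if "G \<in> \<G>" "H \<in> \<G>" "G \<noteq> H" for G H
    proof -
      obtain p q where pq: "G = {2 * p, 2 * p + 1}" "H = {2 * q, 2 * q + 1}"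
        using \<open>G \<in> \<G>\<close> \<open>H \<in> \<G>\<close> unfolding \<G>_def by blast
      with \<open>G \<noteq> H\<close> have "p \<noteq> q" by blast
      moreover have "y div 2 = p" if "y \<in> G" for y using that pq by auto
      moreover have "y div 2 = q" if "y \<in> H" for y using that pq by auto
      ultimately show ?thesis by (auto simp: disjnt_def)
    qed
  qed (auto simp: \<G>_def)
  moreover have "card \<G> = v"
  proof -
    have "inj_on (\<lambda>p::nat. {2 * p, 2 * p + 1}) X"
      by (rule inj_onI) (auto simp: doubleton_eq_iff)
    then show ?thesis by (simp add: \<G>_def card_image cardX)
  qed
  moreover have "\<forall>G\<in>\<G>. card G = 4 * m div (2 * m)"
    using m by (auto simp: \<G>_def)
  moreover have "\<forall>j\<in>{1..4 * m}. \<forall>G\<in>\<G>. card (C j \<inter> G) = 1"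
  proof (intro ballI)
    fix j G assume "G \<in> \<G>"
    then obtain p where p: "p \<in> X" and G: "G = {2 * p, 2 * p + 1}" by (auto simp: \<G>_def)
    have "C j \<inter> G = {2 * p + of_bool (p \<in> D j)}"
      using p by (auto simp: G C_def V_def X_def)
    then show "card (C j \<inter> G) = 1" by simp
  qed
  moreover have "\<forall>G\<in>\<G>. \<forall>x\<in>G. \<forall>y\<in>G. \<forall>i\<in>{1..v}. x \<in> R i \<longleftrightarrow> y \<in> R i"
    by (auto simp: \<G>_def R_def V_def X_def)
  moreover have "2 * m > 0" "2 * m dvd 4 * m" using m by auto
  ultimately have "resolvable_unordered_triple_array v (4 * m) (8 * m - 2) V R C"
    unfolding resolvable_unordered_triple_array_def by blast
  then show ?thesis by blast
qed

section \<open>Indexing the given design, and the conclusion\<close>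

text \<open>Listing the multiset gives repeated blocks distinct indices, so multiplicities become
  cardinalities of index sets; a bijection \<open>g\<close> relabels the points by numbers.\<close>

lemma symmetric_two_design_indexed:
  assumes "symmetric_two_design v k l (X :: 'a set) \<B>"
  obtains B :: "nat \<Rightarrow> nat set"
  where "\<And>i. i \<in> {1..v} \<Longrightarrow> B i \<subseteq> {..<v}"
    and "\<And>i. i \<in> {1..v} \<Longrightarrow> card (B i) = k"
    and "\<And>p q. p < v \<Longrightarrow> q < v \<Longrightarrow> p \<noteq> q \<Longrightarrow> card {i\<in>{1..v}. p \<in> B i \<and> q \<in> B i} = l"
proof -
  have finX: "finite X" and cardX: "card X = v" and size: "size \<B> = v"
    and blocks: "\<And>A. A \<in># \<B> \<Longrightarrow> A \<subseteq> X \<and> card A = k"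
    and pairs: "\<And>x y. x \<in> X \<Longrightarrow> y \<in> X \<Longrightarrow> x \<noteq> y \<Longrightarrow> size {#A \<in># \<B>. x \<in> A \<and> y \<in> A#} = l"
    using assms by (auto simp: symmetric_two_design_def two_design_def)
  obtain g where g: "bij_betw g {..<v} X"
    using ex_bij_betw_nat_finite[OF finX] cardX by (auto simp: lessThan_atLeast0)
  obtain As where As: "\<B> = mset As" using ex_mset by metis
  have len: "length As = v" using size As by simp
  define B where "B i = {p\<in>{..<v}. g p \<in> As ! (i - 1)}" for i
  show thesis
  proof
    show "B i \<subseteq> {..<v}" for i by (auto simp: B_def)
  next
    fix i assume "i \<in> {1..v}"
    then have "As ! (i - 1) \<in># \<B>" using len by (auto simp: As)
    then have A: "As ! (i - 1) \<subseteq> X" "card (As ! (i - 1)) = k" using blocks by auto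
    have "g ` B i = As ! (i - 1)"
      using A(1) g by (auto simp: B_def bij_betw_def)
    moreover have "inj_on g (B i)"
      using g by (auto simp: B_def bij_betw_def intro: inj_on_subset)
    ultimately show "card (B i) = k" using A(2) card_image by metis
  next
    fix p q assume pq: "p < v" "q < v" "p \<noteq> q"
    have "g p \<in> X" "g q \<in> X" "g p \<noteq> g q"
      using g pq by (auto simp: bij_betw_def inj_on_def)
    then have "l = card {i. i < v \<and> g p \<in> As ! i \<and> g q \<in> As ! i}"
      using pairs[of "g p" "g q"] len by (simp add: As length_filter_conv_card flip: mset_filter)
    \<comment> \<open>List positions start at 0 and block indices at 1; \<open>Suc\<close>
      translates between them.\<close>
    also have "\<dots> = card (Suc ` {i. i < v \<and> g p \<in> As ! i \<and> g q \<in> As ! i})"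
      by (simp add: card_image)
    also have "Suc ` {i. i < v \<and> g p \<in> As ! i \<and> g q \<in> As ! i} = {i\<in>{1..v}. p \<in> B i \<and> q \<in> B i}"
    proof (intro equalityI subsetI)
      fix i assume "i \<in> {i\<in>{1..v}. p \<in> B i \<and> q \<in> B i}"
      then show "i \<in> Suc ` {i. i < v \<and> g p \<in> As ! i \<and> g q \<in> As ! i}"
        by (intro image_eqI[of _ _ "i - 1"]) (auto simp: B_def)
    qed (use pq in \<open>auto simp: B_def\<close>)
    finally show "card {i\<in>{1..v}. p \<in> B i \<and> q \<in> B i} = l" by simp
  qed
qed

theorem theorem6:
  fixes m :: nat
  assumes "m > 0"
    and "\<exists>(X :: 'a set) \<B>. symmetric_two_design (4 * m - 1) (2 * m - 1) (m - 1) X \<B>"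
  shows "\<exists>(V :: nat set) R C.
           resolvable_unordered_triple_array (4 * m - 1) (4 * m) (8 * m - 2) V R C"
proof (cases "m = 1")
  case True
  \<comment> \<open>In the family of singletons \<open>{i - 1}\<close>, the point \<open>p\<close>
    lies only in the block with index \<open>Suc p\<close>, so the replication number is 1 and
    distinct blocks are disjoint.\<close>
  have "{i \<in> {Suc 0..3}. p = i - Suc 0} = {Suc p}" if "p < 3" for p
    using that by auto
  then show ?thesis
    using True by (intro resolvable_array_of_dual_design[where B = "\<lambda>i. {i - 1}"]) auto
next
  case False
  let ?v = "4 * m - 1"
  obtain X :: "'a set" and \<B> where "symmetric_two_design ?v (2 * m - 1) (m - 1) X \<B>"
    using assms(2) by blast
  then obtain B :: "nat \<Rightarrow> nat set" where
    B: "\<And>i. i \<in> {1..?v} \<Longrightarrow> B i \<subseteq> {..<?v}"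
      "\<And>i. i \<in> {1..?v} \<Longrightarrow> card (B i) = 2 * m - 1"
      "\<And>p q. p < ?v \<Longrightarrow> q < ?v \<Longrightarrow> p \<noteq> q \<Longrightarrow> card {i\<in>{1..?v}. p \<in> B i \<and> q \<in> B i} = m - 1"
    by (rule symmetric_two_design_indexed) blast
  have k2: "2 * m - 1 \<ge> 2" using assms(1) False by simp
  show ?thesis
  proof (rule resolvable_array_of_dual_design[OF assms(1) B(1,2)])
    show "card {i\<in>{1..?v}. p \<in> B i} = 2 * m - 1" if "p < ?v" for p
      by (rule symmetric_design_replication[of _ ?v "{..<?v}" _ _ "m - 1"]) (use B k2 that in auto)
    show "card (B i \<inter> B j) = m - 1" if "i \<in> {1..?v}" "j \<in> {1..?v}" "i \<noteq> j" for i j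
      by (rule symmetric_design_block_intersection[of "{1..?v}" ?v "{..<?v}" _ "2 * m - 1"])
        (use B k2 that in auto)
  qed
qed

end
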